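(* Let $f=x^{2}+a_{1}x+a_{0}\in\mathbb{R}[x]$ have no real roots, and let $\alpha=re^{i\theta}$ (with $r>0$, $0<\theta<\pi$) be the non-real root of $f$ with positive imaginary part. Then the smallest degree of a non-zero polynomial $g\in\mathbb{R}[x]$ such that $\operatorname{coeffs}(gf)\geq 0$ is $$s=\left\lceil \frac{\pi}{\theta}\right\rceil -2 .$$
   Context: For a polynomial $h\in\mathbb{R}[x]$, $\operatorname{coeffs}(h)\geq 0$ means that all coefficients of $h$ are non-negative. *)

theory Defs
  imports Complex_Main "HOL-Computational_Algebra.Polynomial"
begin

definition coeffs_nonneg :: "real poly \<Rightarrow> bool" where
  "coeffs_nonneg h \<longleftrightarrow> (\<forall>i. 0 \<le> coeff h i)"

end

theory Submission
  imports Defs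
begin

text \<open>
  Write \<open>n = \<lceil>pi / \<theta>\<rceil>\<close>, so that \<open>(n - 1) \<theta> < pi \<le> n \<theta> < 2 pi\<close>. A multiple \<open>h\<close> of \<open>f\<close> satisfies
  \<open>Im (h \<alpha>) = (\<Sum>k. h\<^sub>k r\<^sup>k sin (k \<theta>)) = 0\<close>. If \<open>2 \<le> deg h < n\<close> and the coefficients are non-negative,
  the leading term of this sum is positive and the others are non-negative, which is absurd.
  Conversely, the trinomial \<open>x\<^sup>n + b x + c\<close> that vanishes at \<open>\<alpha>\<close> has
  \<open>b = - r\<^sup>n\<^sup>-\<^sup>1 sin (n \<theta>) / sin \<theta> \<ge> 0\<close> and \<open>c = r\<^sup>n sin ((n - 1) \<theta>) / sin \<theta> > 0\<close>.
\<close>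

lemma map_poly_of_real_mult:
  fixes p q :: "real poly"
  shows "map_poly complex_of_real (p * q) = map_poly complex_of_real p * map_poly complex_of_real q"
  by (rule poly_eqI) (simp add: coeff_map_poly coeff_mult)

lemma map_poly_of_real_add:
  fixes p q :: "real poly"
  shows "map_poly complex_of_real (p + q) = map_poly complex_of_real p + map_poly complex_of_real q"
  by (rule poly_eqI) (simp add: coeff_map_poly)

lemma poly_map_poly_of_real:
  fixes p :: "real poly"
  shows "poly (map_poly complex_of_real p) z = (\<Sum>k\<le>degree p. complex_of_real (coeff p k) * z ^ k)"
  by (simp add: poly_altdef degree_map_poly coeff_map_poly)

text \<open>The remainder of \<open>q\<close> modulo \<open>p\<close> is a real polynomial of degree
  at most 1 that still vanishes at \<open>z\<close>. Since \<open>z\<close> is not real, the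
  imaginary part kills its slope and then the real part kills its constant term.\<close>

lemma quadratic_dvd_if_root:
  fixes p q :: "real poly"
  assumes deg: "degree p = 2" and nonreal: "Im z \<noteq> 0"
    and p: "poly (map_poly complex_of_real p) z = 0"
    and q: "poly (map_poly complex_of_real q) z = 0"
  shows "p dvd q"
proof -
  define s where "s = q mod p"
  \<comment> \<open>The zero remainder is covered as well, because its degree is 0 by
    convention.\<close>
  have "degree s < 2"
    using deg unfolding s_def by (metis degree_0 degree_mod_less not_less_zero pos2)
  then have "degree s \<le> 1" by simp
  then have s: "s = [:coeff s 0, coeff s 1:]"
    by (intro poly_eqI) (auto simp: coeff_pCons coeff_eq_0 split: nat.split)
  have "q = q div p * p + s"
    by (simp add: s_def)
  then have "poly (map_poly complex_of_real q) z =
      poly (map_poly complex_of_real (q div p)) z * poly (map_poly complex_of_real p) z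
      + poly (map_poly complex_of_real s) z"
    by (metis map_poly_of_real_mult map_poly_of_real_add poly_add poly_mult)
  with p q have "poly (map_poly complex_of_real s) z = 0"
    by simp
  then have "complex_of_real (coeff s 0) + z * complex_of_real (coeff s 1) = 0"
    by (subst (asm) s) (simp add: map_poly_pCons)
  then have "coeff s 1 * Im z = 0" "coeff s 0 + Re z * coeff s 1 = 0"
    by (auto simp: complex_eq_iff)
  with nonreal have "s = 0"
    by (subst s) simp
  then show ?thesis
    by (simp add: s_def dvd_eq_mod_eq_0)
qed

lemma rcis_root_nonneg_poly_degree:
  fixes h :: "real poly"
  assumes "coeffs_nonneg h" "h \<noteq> 0" "0 < degree h"
    and r: "0 < r" and "0 < \<theta>"
    and root: "poly (map_poly complex_of_real h) (rcis r \<theta>) = 0"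
  shows "pi \<le> real (degree h) * \<theta>"
proof (rule ccontr)
  assume "\<not> pi \<le> real (degree h) * \<theta>"
  then have less: "real (degree h) * \<theta> < pi" by simp
  \<comment> \<open>All angles \<open>k * \<theta>\<close> up to the top degree lie strictly between
    0 and \<open>pi\<close>.\<close>
  have sin_pos: "0 < sin (real k * \<theta>)" if "0 < k" "k \<le> degree h" for k
  proof (rule sin_gt_zero)
    show "0 < real k * \<theta>" using that \<open>0 < \<theta>\<close> by simp
    have "real k * \<theta> \<le> real (degree h) * \<theta>"
      using that \<open>0 < \<theta>\<close> by (intro mult_right_mono) auto
    with less show "real k * \<theta> < pi" by simp
  qed
  have "0 < (\<Sum>k\<le>degree h. coeff h k * (r ^ k * sin (real k * \<theta>)))"
  proof (rule sum_pos2[where i = "degree h"])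
    have "0 < lead_coeff h"
      using \<open>coeffs_nonneg h\<close> \<open>h \<noteq> 0\<close> by (simp add: coeffs_nonneg_def order.not_eq_order_implies_strict)
    then show "0 < lead_coeff h * (r ^ degree h * sin (real (degree h) * \<theta>))"
      using sin_pos[of "degree h"] r \<open>0 < degree h\<close> by simp
    \<comment> \<open>The constant term is treated apart: its sine is 0, so \<open>sin_pos\<close>
      does not apply.\<close>
    show "0 \<le> coeff h k * (r ^ k * sin (real k * \<theta>))" if "k \<in> {..degree h}" for k
      using sin_pos[of k] r that \<open>coeffs_nonneg h\<close>
      by (cases "k = 0") (auto simp: coeffs_nonneg_def)
  qed auto
  also have "\<dots> = Im (poly (map_poly complex_of_real h) (rcis r \<theta>))"
    by (simp add: poly_map_poly_of_real DeMoivre2 Im_rcis)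
  finally show False
    using root by simp
qed

lemma nonneg_trinomial_rcis_root:
  assumes n: "2 \<le> n" and r: "0 < r" and theta: "0 < \<theta>" "\<theta> < pi"
    and lower: "(real n - 1) * \<theta> < pi" and upper: "pi \<le> real n * \<theta>"
  obtains h where "coeffs_nonneg h" "degree h = n"
    "poly (map_poly complex_of_real h) (rcis r \<theta>) = 0"
proof
  \<comment> \<open>Vanishing at \<open>rcis r \<theta>\<close> is a triangular linear system: the
    imaginary part determines \<open>b\<close>, and then the real part determines
    \<open>c\<close>.\<close>
  define b where "b = - (r ^ (n - 1) * sin (real n * \<theta>) / sin \<theta>)"
  define c where "c = r ^ n * sin ((real n - 1) * \<theta>) / sin \<theta>"
  define h where "h = monom 1 n + [:c, b:]"
  have sin_theta: "0 < sin \<theta>"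
    using theta by (rule sin_gt_zero)
  \<comment> \<open>Adding \<open>\<theta> < pi\<close> to \<open>lower\<close> keeps
    \<open>n * \<theta>\<close> within the half-turn from \<open>pi\<close> to
    \<open>2 * pi\<close>, where the sine is not positive.\<close>
  have "real n * \<theta> < 2 * pi"
    using lower theta by (simp add: algebra_simps)
  then have "sin (real n * \<theta>) \<le> 0"
    using upper by (intro sin_le_zero) auto
  then have "0 \<le> b"
    using r sin_theta by (simp add: b_def divide_nonpos_pos mult_nonneg_nonpos)
  moreover have "0 \<le> sin ((real n - 1) * \<theta>)"
    using n theta lower by (intro sin_ge_zero) auto
  then have "0 \<le> c"
    using r sin_theta by (simp add: c_def)
  ultimately show "coeffs_nonneg h"
    by (auto simp: coeffs_nonneg_def h_def coeff_pCons split: nat.split)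
  \<comment> \<open>Here \<open>2 \<le> n\<close> keeps the leading monomial clear of the linear
    part.\<close>
  have "degree [:c, b:] < degree (monom (1::real) n)"
    using n by (simp add: degree_monom_eq)
  then show "degree h = n"
    by (simp add: h_def degree_add_eq_left degree_monom_eq)
  have rn: "r ^ n = r * r ^ (n - 1)"
    using n by (simp flip: power_Suc)
  have Im0: "r ^ n * sin (real n * \<theta>) + b * (r * sin \<theta>) = 0"
    using sin_theta by (simp add: b_def rn)
  \<comment> \<open>Expanding the sine of \<open>n * \<theta> - \<theta>\<close> gives one term that
    cancels \<open>b * (r * cos \<theta>)\<close> and one that cancels
    \<open>r ^ n * cos (n * \<theta>)\<close>.\<close>
  have "c = r ^ n * (sin (real n * \<theta>) * cos \<theta> - cos (real n * \<theta>) * sin \<theta>) / sin \<theta>"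
    by (simp add: c_def left_diff_distrib sin_diff)
  then have Re0: "r ^ n * cos (real n * \<theta>) + c + b * (r * cos \<theta>) = 0"
    using sin_theta by (simp add: b_def rn field_simps)
  have "poly (map_poly complex_of_real h) (rcis r \<theta>)
      = rcis r \<theta> ^ n + complex_of_real c + rcis r \<theta> * complex_of_real b"
    by (simp add: h_def map_poly_of_real_add map_poly_monom map_poly_pCons poly_monom)
  also have "\<dots> = 0"
    using Im0 Re0 by (simp add: complex_eq_iff DeMoivre2 Re_rcis Im_rcis algebra_simps)
  finally show "poly (map_poly complex_of_real h) (rcis r \<theta>) = 0" .
qed

theorem theorem1:
  fixes a0 a1 r \<theta> :: real and f :: "real poly" and \<alpha> :: complex
  assumes f: "f = [:a0, a1, 1:]"
    and no_real_roots: "\<forall>x. poly f x \<noteq> 0"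
    and root: "poly (map_poly complex_of_real f) \<alpha> = 0"
    and Im_pos: "Im \<alpha> > 0"
    and polar: "\<alpha> = complex_of_real r * exp (\<i> * complex_of_real \<theta>)"
    and r: "r > 0"
    and theta: "0 < \<theta>" "\<theta> < pi"
  shows "(\<exists>g. g \<noteq> 0 \<and> coeffs_nonneg (g * f) \<and> int (degree g) = \<lceil>pi / \<theta>\<rceil> - 2)
       \<and> (\<forall>g. g \<noteq> 0 \<and> coeffs_nonneg (g * f) \<longrightarrow> \<lceil>pi / \<theta>\<rceil> - 2 \<le> int (degree g))"
proof
  have alpha: "\<alpha> = rcis r \<theta>"
    by (simp add: polar rcis_def cis_conv_exp)
  have deg_f: "degree f = 2" and "f \<noteq> 0"
    by (simp_all add: f)
  define n where "n = nat \<lceil>pi / \<theta>\<rceil>"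
  \<comment> \<open>This makes the ceiling at least 2, so that \<open>nat\<close> loses nothing and
    the trinomial has degree at least that of \<open>f\<close>.\<close>
  have "1 < pi / \<theta>"
    using theta by simp
  then have n: "int n = \<lceil>pi / \<theta>\<rceil>" "2 \<le> n"
    unfolding n_def by linarith+
  then have "real n - 1 < pi / \<theta>" "pi / \<theta> \<le> real n"
    by linarith+
  then have "(real n - 1) * \<theta> < pi" "pi \<le> real n * \<theta>"
    using theta by (simp_all add: field_simps)
  then obtain h where h: "coeffs_nonneg h" "degree h = n"
      "poly (map_poly complex_of_real h) \<alpha> = 0"
    using nonneg_trinomial_rcis_root[OF n(2) r theta] unfolding alpha by metis
  have "f dvd h"
    using quadratic_dvd_if_root[OF deg_f _ root h(3)] Im_pos by simp
  then obtain g where g: "h = g * f"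
    by (metis dvdE mult.commute)
  have "g \<noteq> 0"
    using h(2) n(2) by (auto simp: g)
  moreover have "degree g + 2 = n"
    using h(2) \<open>g \<noteq> 0\<close> \<open>f \<noteq> 0\<close> by (simp add: g degree_mult_eq deg_f)
  ultimately show "\<exists>g. g \<noteq> 0 \<and> coeffs_nonneg (g * f) \<and> int (degree g) = \<lceil>pi / \<theta>\<rceil> - 2"
    using h(1) n(1) by (intro exI[of _ g]) (auto simp: g)
  show "\<forall>g. g \<noteq> 0 \<and> coeffs_nonneg (g * f) \<longrightarrow> \<lceil>pi / \<theta>\<rceil> - 2 \<le> int (degree g)"
  proof (intro allI impI, elim conjE)
    fix g :: "real poly"
    assume g: "g \<noteq> 0" "coeffs_nonneg (g * f)"
    have deg: "degree (g * f) = degree g + 2"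
      using g(1) \<open>f \<noteq> 0\<close> by (simp add: degree_mult_eq deg_f)
    have "poly (map_poly complex_of_real (g * f)) (rcis r \<theta>) = 0"
      using root by (simp add: map_poly_of_real_mult alpha)
    \<comment> \<open>The factor \<open>f\<close> alone makes the degree of \<open>g * f\<close>
      positive, even for constant \<open>g\<close>.\<close>
    then have "pi \<le> real (degree g + 2) * \<theta>"
      using rcis_root_nonneg_poly_degree[OF g(2) _ _ r theta(1)] g(1) \<open>f \<noteq> 0\<close> by (simp add: deg)
    then have "pi / \<theta> \<le> real (degree g + 2)"
      using theta by (simp add: field_simps)
    then show "\<lceil>pi / \<theta>\<rceil> - 2 \<le> int (degree g)"
      by linarith
  qed
qed

end
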